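(* Let $n \ge 2$, let $G$ be a graph on the vertex set $[n]=\{1,\dots,n\}$, and let $w_G(t)=(w_1(t),\dots,w_n(t))$, $t=0,1,2,\dots$, be the evolution of the diffusion game on $G$ from an integer initial labelling $w_G(0)$. If $w_G(0)\ge f(n)=n-2$ (that is, $w_v(0)\ge n-2$ for every $v\in[n]$), then at all times $t\ge 0$ we have $w_G(t)\ge 0$ (that is, $w_v(t)\ge 0$ for every $v\in[n]$).
   Context: Graphs are simple and undirected; $\Gamma(v)$ denotes the set of neighbours of $v$. Diffusion game: each vertex $v\in[n]$ has an initial integer label $w_v(0)\in\mathbb{Z}$ (number of chips), and all labels are updated simultaneously at discrete times $t=0,1,2,\dots$ by $$w_v(t+1)=w_v(t)+|\{u\in\Gamma(v): w_u(t)>w_v(t)\}|-|\{u\in\Gamma(v): w_u(t)<w_v(t)\}|.$$ For an integer $k$, $w_G(t)\ge k$ means $w_v(t)\ge k$ for all $v\in[n]$. Labels are allowed to become negative. *)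

theory Defs
  imports "Graph_Theory.Graph_Theory"
begin

(* A simple undirected graph is a pair_graph: finite, loop-free, with a symmetric
   arc relation, so every edge {u, v} is present as both (u, v) and (v, u). *)

definition neighbours :: "'a pair_pre_digraph \<Rightarrow> 'a \<Rightarrow> 'a set" where
  "neighbours G v = {u. (v, u) \<in> parcs G}"

definition diffusion_step :: "'a pair_pre_digraph \<Rightarrow> ('a \<Rightarrow> int) \<Rightarrow> 'a \<Rightarrow> int" where
  "diffusion_step G w v =
     w v + int (card {u \<in> neighbours G v. w u > w v})
         - int (card {u \<in> neighbours G v. w u < w v})"

(* Labels are total functions; only the values on pverts G are relevant, since
   neighbours of a vertex are again vertices. *)

primrec diffusion :: "'a pair_pre_digraph \<Rightarrow> ('a \<Rightarrow> int) \<Rightarrow> nat \<Rightarrow> 'a \<Rightarrow> int" where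
  "diffusion G w0 0 = w0"
| "diffusion G w0 (Suc t) = diffusion_step G (diffusion G w0 t)"

definition labels_at_least :: "'a pair_pre_digraph \<Rightarrow> ('a \<Rightarrow> int) \<Rightarrow> int \<Rightarrow> bool" where
  "labels_at_least G w k \<longleftrightarrow> (\<forall>v\<in>pverts G. w v \<ge> k)"

end

theory Submission
  imports Defs
begin

text \<open>
  The invariant is that every set of \<open>k\<close> vertices carries at least \<open>k * (k - 2)\<close> chips. In one step
  a set \<open>S\<close> loses at most one chip for each inversion, that is, each pair of a vertex in \<open>S\<close> and a
  lower vertex outside \<open>S\<close>. So it suffices that chips minus inversions minus \<open>k * (k - 2)\<close> is
  nonnegative. A set minimizing this quantity, and of least size among the minimizers, has no
  inversions at all: for an inversion \<open>(a, b)\<close> between adjacent vertices, removing \<open>a\<close> and adding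
  \<open>b\<close> change the quantity by amounts whose sum is at most \<open>0\<close>. Finally, the invariant, applied to
  a vertex \<open>v\<close> together with all lower vertices, shows that \<open>v\<close> has at least as many chips as
  there are lower vertices, so it cannot become negative in the next step.
\<close>

section \<open>Inversions between a vertex set and its complement\<close>

definition inversions :: "('a \<Rightarrow> 'b::linorder) \<Rightarrow> 'a set \<Rightarrow> 'a set \<Rightarrow> ('a \<times> 'a) set" where
  "inversions y V S = {(a, b). a \<in> S \<and> b \<in> V - S \<and> y b < y a}"

lemma finite_inversions:
  assumes "finite V" "S \<subseteq> V"
  shows "finite (inversions y V S)"
  by (rule finite_subset[of _ "V \<times> V"]) (use assms in \<open>auto simp: inversions_def\<close>)

lemma card_inversions_eq_sum:
  assumes "finite V" "S \<subseteq> V"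
  shows "card (inversions y V S) = (\<Sum>a\<in>S. card {b \<in> V - S. y b < y a})"
proof -
  have "inversions y V S = (SIGMA a:S. {b \<in> V - S. y b < y a})"
    by (auto simp: inversions_def)
  then show ?thesis
    using assms(1) finite_subset[OF assms(2,1)] by simp
qed

text \<open>Pairs avoiding \<open>b\<close> are common to both sets. Moving \<open>b\<close> into
  \<open>S\<close> destroys the pairs \<open>(c, b)\<close> and creates the pairs
  \<open>(b, d)\<close>. The additive form avoids subtraction of naturals.\<close>

lemma card_inversions_insert:
  assumes "finite V" "S \<subseteq> V" "b \<in> V - S"
  shows "card (inversions y V (insert b S)) + card {c \<in> S. y b < y c} =
         card (inversions y V S) + card {d \<in> V - insert b S. y d < y b}"
proof -
  let ?I = "inversions y V (insert b S) \<inter> inversions y V S"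
  let ?U = "{c \<in> S. y b < y c}" and ?D = "{d \<in> V - insert b S. y d < y b}"
  have fin: "finite ?I" "finite ?U" "finite ?D"
    using assms finite_inversions[of V S y] finite_subset[OF assms(2,1)] by auto
  have "inversions y V (insert b S) = ?I \<union> {b} \<times> ?D" "?I \<inter> {b} \<times> ?D = {}"
    using assms by (auto simp: inversions_def)
  then have "card (inversions y V (insert b S)) = card ?I + card ?D"
    using card_Un_disjoint[of ?I "{b} \<times> ?D"] fin by (simp add: card_cartesian_product)
  moreover have "inversions y V S = ?I \<union> ?U \<times> {b}" "?I \<inter> ?U \<times> {b} = {}"
    using assms by (auto simp: inversions_def)
  then have "card (inversions y V S) = card ?I + card ?U"
    using card_Un_disjoint[of ?I "?U \<times> {b}"] fin by (simp add: card_cartesian_product)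
  ultimately show ?thesis by simp
qed

lemma finite_has_arg_min:
  fixes f :: "'a \<Rightarrow> 'b::linorder"
  assumes "finite A" "A \<noteq> {}"
  shows "\<exists>a \<in> A. \<forall>c \<in> A. f a \<le> f c"
  by (intro bexI[of _ "arg_min_on f A"] ballI arg_min_least arg_min_if_finite(1) assms)

text \<open>Take \<open>a\<close> lowest among the members of \<open>S\<close> that have a lower
  vertex outside \<open>S\<close>, and \<open>b\<close> highest among those lower vertices. Then no
  vertex of \<open>V\<close> has a key strictly between \<open>y b\<close> and \<open>y a\<close>,
  and injectivity excludes ties. The last two equations record this through the sets counted in
  \<open>card_inversions_insert\<close>.\<close>

lemma adjacent_inversion:
  fixes y :: "'a \<Rightarrow> 'b::linorder"
  assumes "finite V" "S \<subseteq> V" "inj_on y V" "inversions y V S \<noteq> {}"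
  obtains a b where "a \<in> S" "b \<in> V - S" "y b < y a"
    "{d \<in> V - S. y d < y a} = insert b {d \<in> V - insert b S. y d < y b}"
    "{c \<in> S. y b < y c} = insert a {c \<in> S - {a}. y a < y c}"
proof -
  let ?A = "{a \<in> S. \<exists>b \<in> V - S. y b < y a}"
  have "\<exists>a \<in> ?A. \<forall>c \<in> ?A. y a \<le> y c"
    by (rule finite_has_arg_min)
      (use assms finite_subset[OF assms(2,1)] in \<open>auto simp: inversions_def\<close>)
  then obtain a where a: "a \<in> ?A" and amin: "\<forall>c \<in> ?A. y a \<le> y c"
    by (elim bexE)
  let ?B = "{b \<in> V - S. y b < y a}"
  have fin: "finite (y ` ?B)" and "y ` ?B \<noteq> {}"
    using assms a by auto
  then have "Max (y ` ?B) \<in> y ` ?B" by (rule Max_in)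
  then obtain b where b: "b \<in> ?B" and bMax: "Max (y ` ?B) = y b" by (rule imageE)
  have bmax: "y d \<le> y b" if "d \<in> ?B" for d
    unfolding bMax[symmetric] using fin that by (intro Max_ge imageI)
  have inj: "u = v" if "y u = y v" "u \<in> V" "v \<in> V" for u v
    using assms(3) that by (rule inj_onD)
  have aS: "a \<in> S" and aV: "a \<in> V" and bV: "b \<in> V" and bS: "b \<notin> S" and ba: "y b < y a"
    using a b assms(2) by auto
  have "d = b \<or> y d < y b" if "d \<in> ?B" for d
    using bmax[OF that] inj[OF _ _ bV, of d] that by fastforce
  then have B: "?B = insert b {d \<in> V - insert b S. y d < y b}"
    using bV bS ba by fastforce
  have "c = a \<or> y a < y c" if c: "c \<in> S" "y b < y c" for c
  proof -
    have "c \<in> ?A" using c bV bS by blast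
    then have "y a \<le> y c" using amin by blast
    moreover have "c \<in> V" using c(1) assms(2) by blast
    ultimately show ?thesis using inj[OF _ _ aV, of c] by fastforce
  qed
  then have A: "{c \<in> S. y b < y c} = insert a {c \<in> S - {a}. y a < y c}"
    using aS ba by fastforce
  show thesis
    using aS bV bS ba B A by (intro that) auto
qed

text \<open>The injective key \<open>y\<close> refines the order of the labels \<open>x\<close> by breaking ties.\<close>

lemma sum_ge_inversions:
  fixes x :: "'a \<Rightarrow> int" and y :: "'a \<Rightarrow> 'b::linorder"
  assumes "finite V" "inj_on y V"
    and mono: "\<And>u v. u \<in> V \<Longrightarrow> v \<in> V \<Longrightarrow> y u < y v \<Longrightarrow> x u \<le> x v"
    and bound: "\<And>T. T \<subseteq> V \<Longrightarrow> sum x T \<ge> int (card T) * (int (card T) - 2)"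
    and "S \<subseteq> V"
  shows "sum x S \<ge> int (card S) * (int (card S) - 2) + int (card (inversions y V S))"
proof -
  define \<Phi> where "\<Phi> T = sum x T - int (card (inversions y V T))
    - int (card T) * (int (card T) - 2)" for T
  have "\<exists>R \<in> Pow V. \<forall>T \<in> Pow V. \<Phi> R \<le> \<Phi> T"
    by (rule finite_has_arg_min) (use \<open>finite V\<close> in auto)
  then obtain R where "R \<in> Pow V" and Rmin: "\<forall>T \<in> Pow V. \<Phi> R \<le> \<Phi> T"
    by (elim bexE)
  \<comment> \<open>Least size among the minimizers makes the removal of \<open>a\<close> raise
    \<open>\<Phi>\<close> strictly. Without strictness the case \<open>x a = x b\<close> would give
    no contradiction.\<close>
  let ?M = "{T \<in> Pow V. \<Phi> T = \<Phi> R}"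
  have "\<exists>Q \<in> ?M. \<forall>T \<in> ?M. card Q \<le> card T"
    by (rule finite_has_arg_min) (use \<open>R \<in> Pow V\<close> \<open>finite V\<close> in auto)
  then obtain Q where Q: "Q \<in> ?M" and Qmin: "\<forall>T \<in> ?M. card Q \<le> card T"
    by (elim bexE)
  have "Q \<subseteq> V" using Q by simp
  have \<Phi>min: "\<Phi> Q \<le> \<Phi> T" if "T \<subseteq> V" for T
    using Q Rmin that by simp
  have "finite Q" using \<open>Q \<subseteq> V\<close> \<open>finite V\<close> by (rule finite_subset)
  have "inversions y V Q = {}"
  proof (rule ccontr)
    assume ne: "inversions y V Q \<noteq> {}"
    obtain a b where ab: "a \<in> Q" "b \<in> V - Q" "y b < y a"
      and D: "{d \<in> V - Q. y d < y a} = insert b {d \<in> V - insert b Q. y d < y b}"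
      and U: "{c \<in> Q. y b < y c} = insert a {c \<in> Q - {a}. y a < y c}"
      by (rule adjacent_inversion[OF \<open>finite V\<close> \<open>Q \<subseteq> V\<close> assms(2) ne]) (rule that)
    have "card (Q - {a}) < card Q"
      using \<open>finite Q\<close> ab(1) by (rule card_Diff1_less)
    then have "Q - {a} \<notin> ?M" using Qmin leD by blast
    moreover have "Q - {a} \<subseteq> V" using \<open>Q \<subseteq> V\<close> by blast
    ultimately have "\<Phi> (Q - {a}) \<noteq> \<Phi> Q" using Q by simp
    then have "\<Phi> Q < \<Phi> (Q - {a})"
      using \<Phi>min[OF \<open>Q - {a} \<subseteq> V\<close>] by simp
    moreover have "\<Phi> Q \<le> \<Phi> (insert b Q)"
      using \<Phi>min ab \<open>Q \<subseteq> V\<close> by simp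
    \<comment> \<open>The change in the inversion counts contributes \<open>2\<close>, and the
      second difference of \<open>k * (k - 2)\<close> contributes \<open>-2\<close>, so only the
      labels of \<open>a\<close> and \<open>b\<close> remain.\<close>
    moreover have "\<Phi> (Q - {a}) + \<Phi> (insert b Q) = 2 * \<Phi> Q + x b - x a"
    proof -
      have cD: "card {d \<in> V - Q. y d < y a} = Suc (card {d \<in> V - insert b Q. y d < y b})"
        unfolding D using \<open>finite V\<close> by simp
      have cU: "card {c \<in> Q. y b < y c} = Suc (card {c \<in> Q - {a}. y a < y c})"
        unfolding U using \<open>finite Q\<close> by simp
      have "a \<in> V" using ab(1) \<open>Q \<subseteq> V\<close> by auto
      \<comment> \<open>The insertion formula, read as putting \<open>a\<close> back into
        \<open>Q - {a}\<close>.\<close>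
      then have "card (inversions y V Q) + card {c \<in> Q - {a}. y a < y c} =
          card (inversions y V (Q - {a})) + card {d \<in> V - Q. y d < y a}"
        using card_inversions_insert[of V "Q - {a}" a y] \<open>finite V\<close> \<open>Q \<subseteq> V\<close> ab(1)
        by (simp add: insert_absorb insert_Diff subset_iff)
      moreover have "card (inversions y V (insert b Q)) + card {c \<in> Q. y b < y c} =
          card (inversions y V Q) + card {d \<in> V - insert b Q. y d < y b}"
        by (rule card_inversions_insert) fact+
      ultimately have inv: "int (card (inversions y V (Q - {a}))) + int (card (inversions y V (insert b Q)))
          = 2 * int (card (inversions y V Q)) - 2"
        using cD cU by linarith
      obtain k where k: "card Q = Suc k"
        using ab(1) \<open>finite Q\<close> by (metis card_Suc_Diff1)
      then have cards: "card (Q - {a}) = k" "card (insert b Q) = Suc (Suc k)"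
        using ab \<open>finite Q\<close> by auto
      have sums: "sum x (Q - {a}) = sum x Q - x a" "sum x (insert b Q) = sum x Q + x b"
        using ab \<open>finite Q\<close> by (auto simp: sum_diff1)
      show ?thesis
        using inv unfolding \<Phi>_def cards k sums by (simp add: algebra_simps)
    qed
    moreover have "x b \<le> x a" using mono[of b a] ab \<open>Q \<subseteq> V\<close> by auto
    ultimately show False by linarith
  qed
  then have "0 \<le> \<Phi> Q" using bound[OF \<open>Q \<subseteq> V\<close>] by (simp add: \<Phi>_def)
  also have "\<dots> \<le> \<Phi> S" using \<Phi>min assms(5) by blast
  finally show ?thesis by (simp add: \<Phi>_def)
qed

section \<open>One step of the game\<close>

lemma neighbours_subset:
  assumes "pair_graph G"
  shows "neighbours G v \<subseteq> pverts G"
proof -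
  interpret pair_graph G by fact
  show ?thesis by (auto simp: neighbours_def dest: in_arcsD2)
qed

lemma neighbours_sym:
  assumes "pair_graph G"
  shows "u \<in> neighbours G v \<longleftrightarrow> v \<in> neighbours G u"
proof -
  interpret pair_graph G by fact
  show ?thesis using arcs_symmetric by (auto simp: neighbours_def)
qed

text \<open>Exchanges along edges inside \<open>S\<close> cancel.\<close>

lemma sum_diffusion_step_ge:
  assumes G: "pair_graph G" and "S \<subseteq> pverts G"
  shows "sum (diffusion_step G w) S \<ge>
    sum w S - (\<Sum>a\<in>S. int (card {b \<in> pverts G - S. w b < w a}))"
proof -
  interpret pair_graph G by fact
  let ?N = "neighbours G"
  have fV: "finite (pverts G)" by (rule pair_finite_verts)
  then have fS: "finite S" using assms finite_subset by blast
  have fN: "finite (?N v)" for v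
    using neighbours_subset[OF G] fV by (rule finite_subset)
  have card_filter: "card {u \<in> S. P u} = (\<Sum>u\<in>S. if P u then 1 else 0)" for P
    using fS by (simp add: sum.If_cases Int_def)
  define up where "up a = card {u \<in> S. u \<in> ?N a \<and> w u > w a}" for a
  define dn where "dn a = card {u \<in> S. u \<in> ?N a \<and> w u < w a}" for a
  have "(\<Sum>a\<in>S. up a) = (\<Sum>a\<in>S. \<Sum>u\<in>S. if u \<in> ?N a \<and> w u > w a then 1 else 0)"
    unfolding up_def by (intro sum.cong refl card_filter)
  \<comment> \<open>Double counting: a gain at one end of an edge inside \<open>S\<close> is a loss
    at the other end.\<close>
  also have "\<dots> = (\<Sum>u\<in>S. \<Sum>a\<in>S. if a \<in> ?N u \<and> w a < w u then 1 else 0)"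
    by (subst sum.swap) (intro sum.cong refl if_cong conj_cong neighbours_sym[OF G])
  also have "\<dots> = (\<Sum>a\<in>S. dn a)"
    unfolding dn_def by (intro sum.cong refl card_filter[symmetric])
  finally have eq: "(\<Sum>a\<in>S. int (up a)) = (\<Sum>a\<in>S. int (dn a))"
    by (simp flip: of_nat_sum)
  \<comment> \<open>Gains from outside \<open>S\<close> are dropped, and losses to the outside are
    bounded by counting all lower vertices there, adjacent or not.\<close>
  have step: "diffusion_step G w a \<ge>
      w a + int (up a) - int (dn a) - int (card {b \<in> pverts G - S. w b < w a})" for a
  proof -
    have "up a \<le> card {u \<in> ?N a. w u > w a}"
      unfolding up_def by (rule card_mono) (use fN in auto)
    moreover have "card {u \<in> ?N a. w u < w a} \<le>
        card ({u \<in> S. u \<in> ?N a \<and> w u < w a} \<union> {b \<in> pverts G - S. w b < w a})"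
      by (rule card_mono) (use fS fV neighbours_subset[OF G] in auto)
    then have "card {u \<in> ?N a. w u < w a} \<le> dn a + card {b \<in> pverts G - S. w b < w a}"
      unfolding dn_def by (rule order_trans[OF _ card_Un_le])
    ultimately show ?thesis unfolding diffusion_step_def by linarith
  qed
  have "sum (diffusion_step G w) S \<ge> (\<Sum>a\<in>S.
      w a + int (up a) - int (dn a) - int (card {b \<in> pverts G - S. w b < w a}))"
    by (rule sum_mono) (rule step)
  then show ?thesis using eq by (simp add: sum.distrib sum_subtractf)
qed

text \<open>With \<open>m\<close> lower vertices, each has at most \<open>w v - 1\<close> chips. If
  \<open>w v \<le> m - 1\<close>, the bound for these \<open>m + 1\<close> vertices forces
  \<open>m \<le> 0\<close>, hence \<open>w v < 0\<close>.\<close>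

lemma label_ge_card_lower:
  fixes w :: "'a \<Rightarrow> int"
  assumes "finite V" "v \<in> V" "w v \<ge> 0"
    and bound: "\<And>T. T \<subseteq> V \<Longrightarrow> sum w T \<ge> int (card T) * (int (card T) - 2)"
  shows "w v \<ge> int (card {u \<in> V. w u < w v})"
proof (rule ccontr)
  let ?L = "{u \<in> V. w u < w v}"
  define m where "m = int (card ?L)"
  assume "\<not> w v \<ge> int (card ?L)"
  then have lt: "w v \<le> m - 1" by (simp add: m_def)
  have "(m + 1) * (m - 1) \<le> sum w (insert v ?L)"
    using bound[of "insert v ?L"] assms(1,2) by (simp add: m_def add.commute)
  also have "\<dots> \<le> w v + m * (w v - 1)"
    using sum_bounded_above[of ?L w "w v - 1"] assms(1) by (simp add: m_def)
  also have "\<dots> \<le> (m - 1) + m * (m - 2)"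
    using lt by (intro add_mono mult_left_mono) (auto simp: m_def)
  finally have "m \<le> 0" by (simp add: algebra_simps)
  then show False using lt assms(3) by linarith
qed

lemma labels_nonneg_step:
  assumes G: "pair_graph G" and "v \<in> pverts G" "w v \<ge> 0"
    and bound: "\<And>T. T \<subseteq> pverts G \<Longrightarrow> sum w T \<ge> int (card T) * (int (card T) - 2)"
  shows "diffusion_step G w v \<ge> 0"
proof -
  interpret pair_graph G by fact
  have fV: "finite (pverts G)" by (rule pair_finite_verts)
  have "card {u \<in> neighbours G v. w u < w v} \<le> card {u \<in> pverts G. w u < w v}"
    by (rule card_mono) (use fV neighbours_subset[OF G] in auto)
  then show ?thesis
    using label_ge_card_lower[OF fV assms(2,3) bound] unfolding diffusion_step_def
    by linarith
qed

text \<open>Distinct labels differ by at least 1, which the factor \<open>n + 1\<close> turns into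
  more than any difference of two indices in \<open>{1..n}\<close>. Equal labels are ordered by
  index.\<close>

lemma inj_on_label_key:
  fixes w :: "nat \<Rightarrow> int"
  shows "inj_on (\<lambda>v. (int n + 1) * w v + int v) {1..n}"
    and "\<And>u v. u \<in> {1..n} \<Longrightarrow> v \<in> {1..n} \<Longrightarrow> w u < w v \<Longrightarrow>
      (int n + 1) * w u + int u < (int n + 1) * w v + int v"
proof -
  show less: "(int n + 1) * w u + int u < (int n + 1) * w v + int v"
    if "u \<in> {1..n}" "v \<in> {1..n}" "w u < w v" for u v
  proof -
    have "(int n + 1) * (w u + 1) \<le> (int n + 1) * w v"
      using that by (intro mult_left_mono) auto
    then show ?thesis using that by (simp add: algebra_simps)
  qed
  show "inj_on (\<lambda>v. (int n + 1) * w v + int v) {1..n}"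
  proof (rule inj_onI)
    fix u v assume uv: "u \<in> {1..n}" "v \<in> {1..n}"
      and eq: "(int n + 1) * w u + int u = (int n + 1) * w v + int v"
    then have "w u = w v" using less[of u v] less[of v u] by linarith
    then show "u = v" using eq by simp
  qed
qed

lemma sum_bound_step:
  fixes G :: "nat pair_pre_digraph"
  assumes G: "pair_graph G" and V: "pverts G = {1..n}"
    and bound: "\<And>T. T \<subseteq> pverts G \<Longrightarrow> sum w T \<ge> int (card T) * (int (card T) - 2)"
    and S: "S \<subseteq> pverts G"
  shows "sum (diffusion_step G w) S \<ge> int (card S) * (int (card S) - 2)"
proof -
  define y where "y v = (int n + 1) * w v + int v" for v
  have inj: "inj_on y (pverts G)"
    and less: "\<And>u v. u \<in> pverts G \<Longrightarrow> v \<in> pverts G \<Longrightarrow> w u < w v \<Longrightarrow> y u < y v"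
    unfolding y_def[abs_def] V by (fact inj_on_label_key)+
  have fV: "finite (pverts G)" using V by simp
  have "int (card S) * (int (card S) - 2) + int (card (inversions y (pverts G) S)) \<le> sum w S"
  proof (rule sum_ge_inversions[OF fV inj _ bound S])
    show "w u \<le> w v" if "u \<in> pverts G" "v \<in> pverts G" "y u < y v" for u v
      using less[of v u] that by force
  qed
  \<comment> \<open>Only an inequality: \<open>y\<close> also counts pairs with equal labels,
    ordered by the tie-break.\<close>
  moreover have "(\<Sum>a\<in>S. card {b \<in> pverts G - S. w b < w a}) \<le> card (inversions y (pverts G) S)"
    unfolding card_inversions_eq_sum[OF fV S]
    by (intro sum_mono card_mono) (use fV S less in auto)
  then have "(\<Sum>a\<in>S. int (card {b \<in> pverts G - S. w b < w a})) \<le>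
      int (card (inversions y (pverts G) S))"
    by (simp flip: of_nat_sum)
  ultimately show ?thesis
    using sum_diffusion_step_ge[OF G S, of w] by linarith
qed

theorem theorem1:
  fixes n :: nat and G :: "nat pair_pre_digraph" and w0 :: "nat \<Rightarrow> int"
  assumes "n \<ge> 2"
    and "pair_graph G"
    and "pverts G = {1..n}"
    and "labels_at_least G (diffusion G w0 0) (int n - 2)"
  shows "\<forall>t. labels_at_least G (diffusion G w0 t) 0"
proof
  fix t
  \<comment> \<open>Nonnegativity is carried along separately, since the sum bound for a single
    vertex gives only \<open>-1\<close>.\<close>
  have "labels_at_least G (diffusion G w0 t) 0 \<and>
    (\<forall>T \<subseteq> pverts G. sum (diffusion G w0 t) T \<ge> int (card T) * (int (card T) - 2))"
  proof (induction t)
    case 0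
    have w0: "w0 v \<ge> int n - 2" if "v \<in> pverts G" for v
      using assms(4) that by (simp add: labels_at_least_def)
    have "sum w0 T \<ge> int (card T) * (int (card T) - 2)" if T: "T \<subseteq> pverts G" for T
    proof -
      \<comment> \<open>Since \<open>card T \<le> n\<close>, the initial minimum
        \<open>n - 2\<close> is at least the average \<open>card T - 2\<close> that the bound
        demands.\<close>
      have "card T \<le> n" using card_mono[of "{1..n}" T] T assms(3) by simp
      then have "int (card T) * (int (card T) - 2) \<le> int (card T) * (int n - 2)"
        by (intro mult_left_mono) auto
      also have "\<dots> \<le> sum w0 T"
        by (rule sum_bounded_below) (use w0 T in auto)
      finally show ?thesis .
    qed
    moreover have "labels_at_least G w0 0"
      using w0 assms(1) unfolding labels_at_least_def by fastforce
    ultimately show ?case by simp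
  next
    case (Suc t)
    then show ?case
      using labels_nonneg_step[OF assms(2), of _ "diffusion G w0 t"]
        sum_bound_step[OF assms(2,3), of "diffusion G w0 t"]
      by (simp add: labels_at_least_def)
  qed
  then show "labels_at_least G (diffusion G w0 t) 0" ..
qed

end
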